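(* Let $L$ be the $n\times n$ Laplacian matrix (symmetric and irreducible) of a graph on $S=\{1,2,\dots,n\}$, let $D=\mathrm{diag}(d_1,\dots,d_n)$ be a real diagonal matrix, let $v\in\mathbb{R}^n$, let $\beta>0$, let $N\ge 1$ be an integer, and put $\Delta t=\beta/N$. Let $(p_{ab}(t))_{a,b\in S}$ be the transition probabilities of the continuous-time Markov chain on $S$ with infinitesimal generator $Q=-L$. Fix $i\in S$, and let $i_1,\dots,i_N$ be random variables with values in $S$ forming a Markov sequence started from $i$ with one-step transition probabilities $p_{ab}(\Delta t)$, i.e. $$\mathbf{P}(i_1=a_1,\dots,i_N=a_N)=p_{i\,a_1}(\Delta t)\prod_{k=2}^{N}p_{a_{k-1}\,a_k}(\Delta t)\qquad\text{for all }a_1,\dots,a_N\in S.$$ Then the entry $i$ of the vector $$\bar{x}=\left(e^{\Delta t D/2}\,e^{-\Delta t L}\,e^{\Delta t D/2}\right)^N v$$ is given by $$\bar{x}_i=e^{\Delta t\,d_i/2}\,\mathbf{E}\Big[\prod_{k=1}^N\eta_k\Big],$$ where $\eta_k=e^{\Delta t\,d_{i_k}}$ for $k=1,\dots,N-1$, and $\eta_N=e^{\Delta t\,d_{i_N}/2}\,v_{i_N}$.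
   Context: The (unnormalized) Laplacian matrix $L$ of a graph on the vertex set $S=\{1,\dots,n\}$ is the matrix whose diagonal entry $L_{ii}$ is the degree of vertex $i$, and whose off-diagonal entry $L_{ij}$ is $-1$ if $(i,j)$ is an edge and $0$ otherwise. It is assumed to be symmetric and irreducible (i.e. the graph is undirected and connected). The numbers $d_i$ denote the diagonal entries of $D$. The transition probability matrix $P(t)=(p_{ij}(t))$ of the continuous-time Markov chain with generator $Q=-L$ is the solution of Kolmogorov's backward equations $P'(t)=Q\,P(t)$, $P(0)=I$ (identity matrix), $t\ge 0$. $\mathbf{E}$ denotes expectation. The vector $\bar x$ is the Strang splitting approximation of $e^{\beta A}v$ with $A=D-L$. *)

theory Defs
  imports "HOL-Probability.Probability"
begin

text \<open>A graph on the finite vertex type \<open>'n\<close> is given by its set of ordered adjacent pairs.\<close>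

definition laplacian :: "('n \<times> 'n) set \<Rightarrow> real^'n^'n" where
  "laplacian E = (\<chi> i j. if i = j then real (card {k. (i, k) \<in> E})
                          else if (i, j) \<in> E then -1 else 0)"

text \<open>A matrix is reducible if a simultaneous permutation of rows and columns makes it block
  triangular with two nonempty diagonal blocks; \<open>I\<close> below is the index set of one block.
  With this convention every matrix of size 1 is irreducible.\<close>

definition irreducible_matrix :: "real^'n^'n \<Rightarrow> bool" where
  "irreducible_matrix A \<longleftrightarrow>
     \<not> (\<exists>I. I \<noteq> {} \<and> I \<noteq> UNIV \<and> (\<forall>i\<in>I. \<forall>j\<in>-I. A $ i $ j = 0))"

definition diag_matrix :: "real^'n \<Rightarrow> real^'n^'n" where
  "diag_matrix d = (\<chi> i j. if i = j then d $ i else 0)"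

primrec matrix_power :: "real^'n^'n \<Rightarrow> nat \<Rightarrow> real^'n^'n" where
  "matrix_power A 0 = mat 1"
| "matrix_power A (Suc k) = A ** matrix_power A k"

text \<open>The library's \<open>exp\<close> and \<open>^\<close> cannot be used: the multiplication of the vector type
  \<open>real^'n^'n\<close> is entrywise, not the matrix product.\<close>

definition matrix_exp :: "real^'n^'n \<Rightarrow> real^'n^'n" where
  "matrix_exp A = (\<Sum>k. matrix_power A k /\<^sub>R fact k)"

text \<open>Transition matrices of the continuous-time Markov chain with generator \<open>Q\<close>: the solution
  for \<open>t \<ge> 0\<close> of the backward equations (the derivative at 0 is one-sided).\<close>

definition transition_matrices :: "real^'n^'n \<Rightarrow> (real \<Rightarrow> real^'n^'n) \<Rightarrow> bool" where
  "transition_matrices Q P \<longleftrightarrow>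
     P 0 = mat 1 \<and>
     (\<forall>t\<ge>0. (P has_vector_derivative Q ** P t) (at t within {0..}))"

text \<open>\<open>X 1, \<dots>, X N\<close> are random variables on \<open>M\<close> forming a Markov sequence started from \<open>i\<close>
  with one-step transition matrix \<open>T\<close>.\<close>

definition markov_sequence ::
  "'a measure \<Rightarrow> real^'n^'n \<Rightarrow> 'n \<Rightarrow> nat \<Rightarrow> (nat \<Rightarrow> 'a \<Rightarrow> 'n) \<Rightarrow> bool" where
  "markov_sequence M T i N X \<longleftrightarrow>
     prob_space M \<and>
     (\<forall>k\<in>{1..N}. X k \<in> measurable M (count_space UNIV)) \<and>
     (\<forall>a :: nat \<Rightarrow> 'n.
        measure M {\<omega> \<in> space M. \<forall>k\<in>{1..N}. X k \<omega> = a k} =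
          T $ i $ a 1 * (\<Prod>k=2..N. T $ a (k - 1) $ a k))"

lemma transpose_laplacian_iff:
  assumes "irrefl E"
  shows "transpose (laplacian E) = laplacian E \<longleftrightarrow> sym E"
proof
  assume T: "transpose (laplacian E) = laplacian E"
  show "sym E"
  proof (rule symI)
    fix i j assume ij: "(i, j) \<in> E"
    with assms have "i \<noteq> j" by (auto simp: irrefl_def)
    have "laplacian E $ j $ i = laplacian E $ i $ j"
      using arg_cong[OF T, of "\<lambda>A. A $ i $ j"] by (simp add: transpose_def)
    with ij \<open>i \<noteq> j\<close> show "(j, i) \<in> E"
      by (auto simp: laplacian_def split: if_splits)
  qed
next
  assume "sym E"
  then have "(j, i) \<in> E \<longleftrightarrow> (i, j) \<in> E" for i j
    by (meson symE)
  then show "transpose (laplacian E) = laplacian E"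
    by (simp add: laplacian_def transpose_def vec_eq_iff)
qed

lemma irreducible_laplacian_iff:
  "irreducible_matrix (laplacian E) \<longleftrightarrow> (\<forall>i j. (i, j) \<in> E\<^sup>*)"
proof
  assume irr: "irreducible_matrix (laplacian E)"
  show "\<forall>i j. (i, j) \<in> E\<^sup>*"
  proof (intro allI, rule ccontr)
    fix i j assume "(i, j) \<notin> E\<^sup>*"
    define I where "I = E\<^sup>* `` {i}"
    have "i \<in> I" "j \<notin> I"
      using \<open>(i, j) \<notin> E\<^sup>*\<close> by (simp_all add: I_def)
    moreover have "laplacian E $ k $ l = 0" if "k \<in> I" "l \<in> -I" for k l
    proof -
      have "k \<noteq> l" using that by blast
      moreover have "(k, l) \<notin> E"
        using that rtrancl_into_rtrancl[of i k E l] by (auto simp: I_def)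
      ultimately show ?thesis by (simp add: laplacian_def)
    qed
    ultimately show False
      using irr unfolding irreducible_matrix_def by blast
  qed
next
  assume conn: "\<forall>i j. (i, j) \<in> E\<^sup>*"
  show "irreducible_matrix (laplacian E)"
    unfolding irreducible_matrix_def
  proof clarify
    fix I assume ne: "I \<noteq> {}" "I \<noteq> UNIV"
      and z: "\<forall>i\<in>I. \<forall>j\<in>-I. laplacian E $ i $ j = 0"
    obtain i j where i: "i \<in> I" and j: "j \<notin> I" using ne by blast
    have "(i, j) \<in> E\<^sup>*" using conn by blast
    then have "j \<in> I"
    proof induction
      case base
      show ?case by (rule i)
    next
      case (step k l)
      show ?case
      proof (rule ccontr)
        assume "l \<notin> I"
        with step z have "laplacian E $ k $ l = 0" "k \<noteq> l" by auto
        with step show False by (simp add: laplacian_def)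
      qed
    qed
    with j show False by blast
  qed
qed

end

theory Submission
  imports Defs
begin

text \<open>
  Because \<open>\<Delta>t D\<close> is diagonal, one Strang step is \<open>K = diag s ** P \<Delta>t ** diag s\<close> with
  \<open>s\<^sub>a = exp (\<Delta>t d\<^sub>a / 2)\<close>, provided that \<open>P \<Delta>t = exp (- \<Delta>t L)\<close>. Expanding the matrix product
  in \<open>(K\<^sup>N v)\<^sub>i\<close> gives a sum over all paths \<open>a\<^sub>1, \<dots>, a\<^sub>N\<close>. The term of a path carries the
  probability of that path for the Markov sequence, and each of its vertices contributes two
  half steps \<open>s\<^sub>a\<^sup>2 = exp (\<Delta>t d\<^sub>a)\<close>, one from each of the adjacent factors \<open>K\<close>; only the
  starting point \<open>i\<close> and the final vertex meet a single factor \<open>K\<close> and contribute one half step.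
  So the sum is \<open>s\<^sub>i\<close> times an expectation written out over the finitely many paths.

  The remaining ingredient is analytic: the backward equations \<open>P' = Q P\<close>, \<open>P 0 = 1\<close> have only
  the solution \<open>exp (t Q)\<close> (\<open>transition_matrices_eq_exp\<close>). The path expansion is
  \<open>sandwich_power_path_sum\<close>, and \<open>expectation_markov_paths\<close> writes an expectation as a
  sum over paths.
\<close>

section \<open>The matrix exponential and the backward equations\<close>

lemma bounded_bilinear_matrix_mult:
  "bounded_bilinear ((**) :: real^'n^'n \<Rightarrow> real^'n^'n \<Rightarrow> real^'n^'n)"
proof -
  have "bilinear ((**) :: real^'n^'n \<Rightarrow> real^'n^'n \<Rightarrow> real^'n^'n)"
    unfolding bilinear_def
    by (auto intro!: linearI simp: matrix_matrix_mult_def vec_eq_iff algebra_simps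
        sum.distrib sum_distrib_left)
  then show ?thesis by (simp add: bilinear_conv_bounded_bilinear)
qed

lemma matrix_power_scaleR: "matrix_power (c *\<^sub>R A) k = c ^ k *\<^sub>R matrix_power A k"
  by (induction k) (simp_all add: bounded_bilinear.scaleR_left[OF bounded_bilinear_matrix_mult]
      bounded_bilinear.scaleR_right[OF bounded_bilinear_matrix_mult])

lemma matrix_power_commute: "A ** matrix_power A k = matrix_power A k ** A"
  by (induction k) (simp_all add: matrix_mul_assoc)

lemma matrix_power_zero_Suc: "matrix_power 0 (Suc k) = 0"
  by (simp add: vec_eq_iff matrix_matrix_mult_def)

text \<open>As the matrix product is bounded bilinear, with constant \<open>C\<close> say, the \<open>k\<close>-th power has norm at
  most \<open>(norm A * C) ^ k\<close> up to a constant, and a scalar exponential series dominates.\<close>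

lemma summable_matrix_exp:
  fixes A :: "real^'n^'n"
  shows "summable (\<lambda>k. matrix_power A k /\<^sub>R fact k)"
proof -
  obtain C where C: "C \<ge> 0"
    "norm (B ** B') \<le> norm B * norm B' * C" for B B' :: "real^'n^'n"
    using bounded_bilinear.nonneg_bounded[OF bounded_bilinear_matrix_mult[where 'n='n]] by blast
  have power: "norm (matrix_power A k) \<le> norm (mat 1 :: real^'n^'n) * (norm A * C) ^ k" for k
  proof (induction k)
    case (Suc k)
    have "norm (matrix_power A (Suc k)) \<le> norm A * norm (matrix_power A k) * C"
      using C(2) by simp
    also have "\<dots> \<le> norm A * (norm (mat 1 :: real^'n^'n) * (norm A * C) ^ k) * C"
      by (intro mult_right_mono mult_left_mono Suc C) auto
    finally show ?case by (simp add: algebra_simps)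
  qed simp
  have "summable (\<lambda>k. norm (mat 1 :: real^'n^'n) * ((norm A * C) ^ k /\<^sub>R fact k))"
    by (intro summable_mult summable_exp_generic)
  then show ?thesis
  proof (rule summable_comparison_test')
    fix k
    show "norm (matrix_power A k /\<^sub>R fact k)
      \<le> norm (mat 1 :: real^'n^'n) * ((norm A * C) ^ k /\<^sub>R fact k)"
      using power[of k] by (simp add: field_simps)
  qed
qed

lemma bounded_linear_matrix_entry: "bounded_linear (\<lambda>A :: real^'n^'m. A $ i $ j)"
  using bounded_linear_compose[OF bounded_linear_vec_nth bounded_linear_vec_nth] .

lemma matrix_exp_entry_sums:
  "(\<lambda>k. matrix_power A k $ i $ j / fact k) sums (matrix_exp A $ i $ j)"
  using bounded_linear.sums[OF bounded_linear_matrix_entry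
      summable_sums[OF summable_matrix_exp[of A]], of i j]
  by (simp add: matrix_exp_def divide_inverse mult.commute)

lemma matrix_exp_scaleR_commute: "A ** matrix_exp (t *\<^sub>R A) = matrix_exp (t *\<^sub>R A) ** A"
proof -
  note bb = bounded_bilinear_matrix_mult
  have "A ** matrix_exp (t *\<^sub>R A) = (\<Sum>k. A ** (matrix_power (t *\<^sub>R A) k /\<^sub>R fact k))"
    unfolding matrix_exp_def
    by (rule bounded_linear.suminf[OF bounded_bilinear.bounded_linear_right[OF bb]
          summable_matrix_exp])
  also have "\<dots> = (\<Sum>k. (matrix_power (t *\<^sub>R A) k /\<^sub>R fact k) ** A)"
    by (simp add: bounded_bilinear.scaleR_left[OF bb] bounded_bilinear.scaleR_right[OF bb]
        matrix_power_scaleR matrix_power_commute)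
  also have "\<dots> = matrix_exp (t *\<^sub>R A) ** A"
    unfolding matrix_exp_def
    by (rule bounded_linear.suminf[OF bounded_bilinear.bounded_linear_left[OF bb]
          summable_matrix_exp, symmetric])
  finally show ?thesis .
qed

lemma matrix_exp_zero: "matrix_exp (0 :: real^'n^'n) = mat 1"
proof -
  have "(\<lambda>k. matrix_power (0 :: real^'n^'n) k /\<^sub>R fact k) =
      (\<lambda>k. if k = 0 then mat 1 else 0)"
    by (rule ext, case_tac k) (simp_all only: matrix_power_zero_Suc, simp_all)
  then show ?thesis
    unfolding matrix_exp_def
    using sums_unique[OF sums_single[of 0 "\<lambda>_. mat 1 :: real^'n^'n"]] by simp
qed

lemma has_vector_derivative_matrixI:
  fixes f :: "real \<Rightarrow> real^'n^'m"
  assumes "\<And>i j. ((\<lambda>t. f t $ i $ j) has_vector_derivative D $ i $ j) (at t within S)"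
  shows "(f has_vector_derivative D) (at t within S)"
  unfolding has_vector_derivative_def
proof (subst has_derivative_componentwise_within, intro ballI)
  fix b :: "real^'n^'m" assume "b \<in> Basis"
  then obtain i j where "b = axis i (axis j 1)"
    by (auto simp: Basis_vec_def)
  with assms[of i j] show "((\<lambda>x. f x \<bullet> b) has_derivative (\<lambda>x. (x *\<^sub>R D) \<bullet> b)) (at t within S)"
    by (simp add: inner_axis has_vector_derivative_def)
qed

text \<open>Each entry of \<open>exp (t A)\<close> is an everywhere convergent power series in \<open>t\<close>, so it may be
  differentiated term by term; the coefficients shift by one, which amounts to a factor \<open>A\<close>.\<close>

lemma matrix_exp_has_vector_derivative:
  "((\<lambda>t. matrix_exp (t *\<^sub>R A)) has_vector_derivative A ** matrix_exp (t *\<^sub>R A)) (at t within S)"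
proof (rule has_vector_derivative_matrixI)
  fix i j
  define c where "c k = matrix_power A k $ i $ j / fact k" for k
  have sums: "(\<lambda>k. c k * x ^ k) sums (matrix_exp (x *\<^sub>R A) $ i $ j)" for x
    using matrix_exp_entry_sums[of "x *\<^sub>R A" i j]
    by (simp add: c_def matrix_power_scaleR mult.commute)
  have "(\<lambda>k. \<Sum>l\<in>UNIV. A $ i $ l * (matrix_power (t *\<^sub>R A) k $ l $ j / fact k)) sums
      (\<Sum>l\<in>UNIV. A $ i $ l * matrix_exp (t *\<^sub>R A) $ l $ j)"
    by (intro sums_sum sums_mult matrix_exp_entry_sums)
  moreover have "(\<Sum>l\<in>UNIV. A $ i $ l * (matrix_power (t *\<^sub>R A) k $ l $ j / fact k)) =
      diffs c k * t ^ k" for k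
  proof -
    have "diffs c k = matrix_power A (Suc k) $ i $ j / fact k"
      by (simp add: diffs_def c_def del: matrix_power.simps of_nat_Suc)
    then show ?thesis
      by (simp add: matrix_power_scaleR matrix_matrix_mult_def sum_distrib_left
          sum_divide_distrib mult_ac)
  qed
  ultimately have "(\<Sum>k. diffs c k * t ^ k) = (A ** matrix_exp (t *\<^sub>R A)) $ i $ j"
    by (simp add: sums_iff matrix_matrix_mult_def)
  moreover have "((\<lambda>x. \<Sum>k. c k * x ^ k) has_field_derivative (\<Sum>k. diffs c k * t ^ k)) (at t)"
    using sums by (intro termdiffs_strong_converges_everywhere) (rule sums_summable)
  ultimately have "((\<lambda>x. matrix_exp (x *\<^sub>R A) $ i $ j) has_field_derivative
      (A ** matrix_exp (t *\<^sub>R A)) $ i $ j) (at t)"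
    using sums by (simp add: sums_iff)
  then show "((\<lambda>x. matrix_exp (x *\<^sub>R A) $ i $ j) has_vector_derivative
      (A ** matrix_exp (t *\<^sub>R A)) $ i $ j) (at t within S)"
    by (simp add: has_real_derivative_iff_has_vector_derivative
        has_vector_derivative_at_within)
qed

text \<open>Uniqueness for the backward equations: along a solution \<open>P\<close>, the product
  \<open>exp ((t - s) Q) P s\<close> has derivative \<open>0\<close> in \<open>s\<close>, because \<open>Q\<close> commutes with its exponential. It
  equals \<open>exp (t Q)\<close> at \<open>s = 0\<close> and \<open>P t\<close> at \<open>s = t\<close>.\<close>

lemma transition_matrices_eq_exp:
  assumes P: "transition_matrices Q P" and "t \<ge> 0"
  shows "P t = matrix_exp (t *\<^sub>R Q)"
proof -
  define F where "F s = matrix_exp ((t - s) *\<^sub>R Q) ** P s" for s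
  have "(F has_vector_derivative 0) (at s within {0..t})" if s: "s \<in> {0..t}" for s
  proof -
    have dP: "(P has_vector_derivative Q ** P s) (at s within {0..t})"
      using P s unfolding transition_matrices_def
      by (intro has_vector_derivative_within_subset[where S="{0..}" and T="{0..t}"]) auto
    have "((\<lambda>s. t - s) has_vector_derivative -1) (at s within {0..t})"
      by (auto intro!: derivative_eq_intros)
    from vector_diff_chain_within[OF this matrix_exp_has_vector_derivative]
    have dE: "((\<lambda>s. matrix_exp ((t - s) *\<^sub>R Q)) has_vector_derivative
        - (Q ** matrix_exp ((t - s) *\<^sub>R Q))) (at s within {0..t})"
      by (simp add: o_def)
    have "(F has_vector_derivative
        matrix_exp ((t - s) *\<^sub>R Q) ** (Q ** P s) +
        (- (Q ** matrix_exp ((t - s) *\<^sub>R Q))) ** P s) (at s within {0..t})"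
      unfolding F_def
      by (rule bounded_bilinear.has_vector_derivative[OF bounded_bilinear_matrix_mult dE dP])
    then show ?thesis
      by (simp add: matrix_exp_scaleR_commute matrix_mul_assoc
          bounded_bilinear.minus_left[OF bounded_bilinear_matrix_mult])
  qed
  then obtain c where "\<And>s. s \<in> {0..t} \<Longrightarrow> F s = c"
    using has_vector_derivative_zero_constant[of "{0..t}" F] by auto
  then have "F t = F 0" using \<open>t \<ge> 0\<close> by simp
  with P show ?thesis
    by (simp add: F_def transition_matrices_def matrix_exp_zero)
qed

lemma matrix_power_diag: "matrix_power (diag_matrix d) k = diag_matrix (\<chi> i. d $ i ^ k)"
proof (induction k)
  case 0
  show ?case by (simp add: diag_matrix_def mat_def vec_eq_iff)
next
  case (Suc k)
  then show ?case
    by (simp add: diag_matrix_def matrix_matrix_mult_def vec_eq_iff if_distrib[of "\<lambda>x. x * _"]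
        cong: if_cong)
qed

lemma matrix_exp_diag: "matrix_exp (diag_matrix d) = diag_matrix (\<chi> i. exp (d $ i))"
proof -
  have "matrix_exp (diag_matrix d) $ i $ j = (if i = j then exp (d $ i) else 0)" for i j
  proof -
    have "(\<lambda>k. matrix_power (diag_matrix d) k $ i $ j / fact k) sums
        (if i = j then exp (d $ i) else 0)"
      using exp_converges[of "d $ i"]
      unfolding matrix_power_diag by (auto simp: diag_matrix_def divide_inverse mult.commute)
    then show ?thesis by (rule sums_unique2[OF matrix_exp_entry_sums])
  qed
  then show ?thesis by (simp add: diag_matrix_def vec_eq_iff)
qed

section \<open>Sums over paths\<close>

lemma sum_PiE_atLeastAtMost_Suc:
  fixes f :: "(nat \<Rightarrow> 'b::finite) \<Rightarrow> real"
  shows "(\<Sum>a\<in>{1..Suc N} \<rightarrow>\<^sub>E UNIV. f a) =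
    (\<Sum>a\<in>{1..N} \<rightarrow>\<^sub>E UNIV. \<Sum>b\<in>UNIV. f (a(Suc N := b)))"
proof -
  have "(\<Sum>a\<in>{1..Suc N} \<rightarrow>\<^sub>E UNIV. f a) =
      (\<Sum>a\<in>(\<lambda>(b, a). a(Suc N := b)) ` (UNIV \<times> ({1..N} \<rightarrow>\<^sub>E UNIV)). f a)"
    by (simp add: atLeastAtMostSuc_conv PiE_insert_eq)
  also have "\<dots> = (\<Sum>(b, a)\<in>UNIV \<times> ({1..N} \<rightarrow>\<^sub>E UNIV). f (a(Suc N := b)))"
    by (subst sum.reindex[OF inj_combinator]) (simp_all add: case_prod_unfold)
  also have "\<dots> = (\<Sum>a\<in>{1..N} \<rightarrow>\<^sub>E UNIV. \<Sum>b\<in>UNIV. f (a(Suc N := b)))"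
    by (simp add: sum.cartesian_product[symmetric] sum.swap[of _ UNIV])
  finally show ?thesis .
qed

definition path_weight :: "real^'n^'n \<Rightarrow> 'n \<Rightarrow> nat \<Rightarrow> (nat \<Rightarrow> 'n) \<Rightarrow> real" where
  "path_weight T i N a = T $ i $ a 1 * (\<Prod>k=2..N. T $ a (k - 1) $ a k)"

lemma path_weight_Suc:
  assumes "N \<ge> 1"
  shows "path_weight T i (Suc N) (a(Suc N := b)) = path_weight T i N a * T $ a N $ b"
proof -
  have "(\<Prod>k=2..N. T $ (a(Suc N := b)) (k - 1) $ (a(Suc N := b)) k) =
      (\<Prod>k=2..N. T $ a (k - 1) $ a k)"
    by (rule prod.cong) auto
  with assms show ?thesis by (simp add: path_weight_def)
qed

text \<open>Summing out the last vertex \<open>b\<close> of a path ending in \<open>c, b\<close> replaces the terminal vector \<open>v\<close>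
  by \<open>K v\<close>: of the weight \<open>s\<^sub>c\<^sup>2\<close> at the now interior vertex \<open>c\<close>, one factor is absorbed in
  \<open>(K v)\<^sub>c = s\<^sub>c (\<Sum>\<^sub>b T\<^sub>c\<^sub>b s\<^sub>b v\<^sub>b)\<close> and the other one is the weight of a final vertex. This is the
  induction step; as the terminal vector changes, the induction runs over all \<open>v\<close>.\<close>

lemma sandwich_power_path_sum:
  fixes T :: "real^'n^'n" and s v :: "real^'n"
  defines "K \<equiv> diag_matrix s ** T ** diag_matrix s"
  assumes "N \<ge> 1"
  shows "(matrix_power K N *v v) $ i =
    s $ i * (\<Sum>a\<in>{1..N} \<rightarrow>\<^sub>E UNIV. path_weight T i N a *
      ((\<Prod>k\<in>{1..<N}. (s $ a k)\<^sup>2) * (s $ a N * v $ a N)))"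
proof -
  have K_apply: "(K *v v) $ c = s $ c * (\<Sum>b\<in>UNIV. T $ c $ b * (s $ b * v $ b))" for v c
    by (simp add: K_def diag_matrix_def matrix_matrix_mult_def matrix_vector_mult_def
        if_distrib[of "\<lambda>x. x * _"] if_distrib[of "\<lambda>x. _ * x"] sum_distrib_left mult.assoc
        cong: if_cong)
  show ?thesis
    using \<open>N \<ge> 1\<close>
  proof (induction N arbitrary: v rule: dec_induct)
    case base
    have "(\<Sum>a\<in>{1..Suc 0} \<rightarrow>\<^sub>E UNIV. path_weight T i (Suc 0) a * (s $ a (Suc 0) * v $ a (Suc 0)))
        = (\<Sum>b\<in>UNIV. T $ i $ b * (s $ b * v $ b))"
      by (subst sum_PiE_atLeastAtMost_Suc) (simp add: path_weight_def)
    then show ?case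
      by (simp add: K_apply)
  next
    case (step N)
    have "matrix_power K (Suc N) *v v = matrix_power K N *v (K *v v)"
      by (simp add: matrix_power_commute matrix_vector_mul_assoc)
    then have "(matrix_power K (Suc N) *v v) $ i =
      s $ i * (\<Sum>a\<in>{1..N} \<rightarrow>\<^sub>E UNIV. path_weight T i N a *
        ((\<Prod>k\<in>{1..<N}. (s $ a k)\<^sup>2) * (s $ a N * (K *v v) $ a N)))"
      using step.IH by simp
    also have "(\<Sum>a\<in>{1..N} \<rightarrow>\<^sub>E UNIV. path_weight T i N a *
        ((\<Prod>k\<in>{1..<N}. (s $ a k)\<^sup>2) * (s $ a N * (K *v v) $ a N))) =
      (\<Sum>a\<in>{1..Suc N} \<rightarrow>\<^sub>E UNIV. path_weight T i (Suc N) a *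
        ((\<Prod>k\<in>{1..<Suc N}. (s $ a k)\<^sup>2) * (s $ a (Suc N) * v $ a (Suc N))))"
      unfolding sum_PiE_atLeastAtMost_Suc
    proof (rule sum.cong[OF refl])
      fix a :: "nat \<Rightarrow> 'n"
      have interior: "(\<Prod>k\<in>{1..<Suc N}. (s $ (a(Suc N := b)) k)\<^sup>2) =
          (\<Prod>k\<in>{1..<N}. (s $ a k)\<^sup>2) * (s $ a N)\<^sup>2" for b
      proof -
        have "(\<Prod>k\<in>{1..<Suc N}. (s $ (a(Suc N := b)) k)\<^sup>2) = (\<Prod>k\<in>{1..<Suc N}. (s $ a k)\<^sup>2)"
          by (rule prod.cong) auto
        with step.hyps show ?thesis by simp
      qed
      show "path_weight T i N a *
          ((\<Prod>k\<in>{1..<N}. (s $ a k)\<^sup>2) * (s $ a N * (K *v v) $ a N)) =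
        (\<Sum>b\<in>UNIV. path_weight T i (Suc N) (a(Suc N := b)) *
          ((\<Prod>k\<in>{1..<Suc N}. (s $ (a(Suc N := b)) k)\<^sup>2) *
            (s $ (a(Suc N := b)) (Suc N) * v $ (a(Suc N := b)) (Suc N))))"
        unfolding interior K_apply path_weight_Suc[OF step.hyps(1)]
        by (simp add: sum_distrib_left power2_eq_square mult_ac)
    qed
    finally show ?case .
  qed
qed

text \<open>The first \<open>N\<close> variables take finitely many joint values, so a function of them is a finite
  combination of indicators of the events whose probabilities are prescribed.\<close>

lemma expectation_markov_paths:
  fixes X :: "nat \<Rightarrow> 'a \<Rightarrow> 'n::finite" and f :: "(nat \<Rightarrow> 'n) \<Rightarrow> real"
  assumes "markov_sequence M T i N X"
    and f: "\<And>a b. (\<And>k. k \<in> {1..N} \<Longrightarrow> a k = b k) \<Longrightarrow> f a = f b"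
  shows "prob_space.expectation M (\<lambda>\<omega>. f (\<lambda>k. X k \<omega>)) =
    (\<Sum>a\<in>{1..N} \<rightarrow>\<^sub>E UNIV. path_weight T i N a * f a)"
proof -
  interpret prob_space M using assms(1) by (simp add: markov_sequence_def)
  have X: "\<And>k. k \<in> {1..N} \<Longrightarrow> X k \<in> measurable M (count_space UNIV)"
    and prob: "\<And>a. prob {\<omega> \<in> space M. \<forall>k\<in>{1..N}. X k \<omega> = a k} = path_weight T i N a"
    using assms(1) by (auto simp: markov_sequence_def path_weight_def)
  define A where "A a = {\<omega> \<in> space M. \<forall>k\<in>{1..N}. X k \<omega> = a k}" for a
  have sets: "A a \<in> events" for a
    unfolding A_def using X by measurable
  have fin: "finite ({1..N} \<rightarrow>\<^sub>E (UNIV :: 'n set))"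
    by (intro finite_PiE) auto
  have "f (\<lambda>k. X k \<omega>) = (\<Sum>a\<in>{1..N} \<rightarrow>\<^sub>E UNIV. indicator (A a) \<omega> * f a)"
    if "\<omega> \<in> space M" for \<omega>
  proof -
    define x where "x = restrict (\<lambda>k. X k \<omega>) {1..N}"
    have x: "x \<in> {1..N} \<rightarrow>\<^sub>E UNIV" by (simp add: x_def)
    have "indicator (A a) \<omega> = (if a = x then 1 else 0 :: real)"
      if "a \<in> {1..N} \<rightarrow>\<^sub>E UNIV" for a
    proof -
      have "\<omega> \<in> A a \<longleftrightarrow> a = x"
      proof
        assume "\<omega> \<in> A a"
        then show "a = x" by (intro PiE_ext[OF that x]) (simp add: A_def x_def)
      qed (use \<open>\<omega> \<in> space M\<close> in \<open>simp add: A_def x_def\<close>)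
      then show ?thesis by (simp add: indicator_def)
    qed
    then have "(\<Sum>a\<in>{1..N} \<rightarrow>\<^sub>E UNIV. indicator (A a) \<omega> * f a) =
        (\<Sum>a\<in>{1..N} \<rightarrow>\<^sub>E UNIV. if a = x then f a else 0)"
      by (intro sum.cong) auto
    also have "\<dots> = f x" using x fin by simp
    also have "\<dots> = f (\<lambda>k. X k \<omega>)" by (rule f) (simp add: x_def)
    finally show ?thesis by simp
  qed
  then have "expectation (\<lambda>\<omega>. f (\<lambda>k. X k \<omega>)) =
      expectation (\<lambda>\<omega>. \<Sum>a\<in>{1..N} \<rightarrow>\<^sub>E UNIV. indicator (A a) \<omega> * f a)"
    by (rule Bochner_Integration.integral_cong[OF refl])
  also have "\<dots> = (\<Sum>a\<in>{1..N} \<rightarrow>\<^sub>E UNIV. expectation (\<lambda>\<omega>. indicator (A a) \<omega> * f a))"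
    using sets
    by (intro Bochner_Integration.integral_sum integrable_mult_left integrable_real_indicator)
      (auto simp: emeasure_eq_measure)
  also have "\<dots> = (\<Sum>a\<in>{1..N} \<rightarrow>\<^sub>E UNIV. path_weight T i N a * f a)"
    using prob by (simp add: A_def Int_def conj_commute)
  finally show ?thesis .
qed

section \<open>The Strang splitting\<close>

theorem theorem2:
  fixes E :: "('n::finite \<times> 'n) set"
    and L D :: "real^'n^'n"
    and d v xbar :: "real^'n"
    and \<beta> \<Delta>t :: real
    and N :: nat
    and P :: "real \<Rightarrow> real^'n^'n"
    and i :: 'n
    and M :: "'a measure"
    and X :: "nat \<Rightarrow> 'a \<Rightarrow> 'n"
    and \<eta> :: "nat \<Rightarrow> 'a \<Rightarrow> real"
  assumes "irrefl E"
    and "L = laplacian E"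
    and "transpose L = L"
    and "irreducible_matrix L"
    and "D = diag_matrix d"
    and "\<beta> > 0"
    and "N \<ge> 1"
    and "\<Delta>t = \<beta> / real N"
    and "transition_matrices (- L) P"
    and "markov_sequence M (P \<Delta>t) i N X"
    and "\<eta> = (\<lambda>k \<omega>. if k < N then exp (\<Delta>t * d $ X k \<omega>)
                    else exp (\<Delta>t * d $ X N \<omega> / 2) * v $ X N \<omega>)"
    and "xbar = matrix_power
                  (matrix_exp ((\<Delta>t / 2) *\<^sub>R D) ** matrix_exp ((- \<Delta>t) *\<^sub>R L)
                     ** matrix_exp ((\<Delta>t / 2) *\<^sub>R D)) N *v v"
  shows "xbar $ i = exp (\<Delta>t * d $ i / 2) * prob_space.expectation M (\<lambda>\<omega>. \<Prod>k=1..N. \<eta> k \<omega>)"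
proof -
  define s :: "real^'n" where "s = (\<chi> a. exp (\<Delta>t * d $ a / 2))"
  have "\<Delta>t \<ge> 0" using assms(6-8) by simp
  have "matrix_exp ((- \<Delta>t) *\<^sub>R L) = P \<Delta>t"
    using transition_matrices_eq_exp[OF assms(9) \<open>\<Delta>t \<ge> 0\<close>] by simp
  moreover have "(\<Delta>t / 2) *\<^sub>R D = diag_matrix (\<chi> a. \<Delta>t * d $ a / 2)"
    by (simp add: assms(5) diag_matrix_def vec_eq_iff)
  then have "matrix_exp ((\<Delta>t / 2) *\<^sub>R D) = diag_matrix s"
    by (simp add: matrix_exp_diag s_def)
  ultimately have xbar: "xbar =
      matrix_power (diag_matrix s ** P \<Delta>t ** diag_matrix s) N *v v"
    using assms(12) by simp
  define f where "f a = (\<Prod>k\<in>{1..<N}. (s $ a k)\<^sup>2) * (s $ a N * v $ a N)" for a :: "nat \<Rightarrow> 'n"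
  have "(\<Prod>k=1..N. \<eta> k \<omega>) = f (\<lambda>k. X k \<omega>)" for \<omega>
  proof -
    have "{1..N} = insert N {1..<N}" using \<open>N \<ge> 1\<close> by auto
    moreover have "(\<Prod>k\<in>{1..<N}. \<eta> k \<omega>) = (\<Prod>k\<in>{1..<N}. (s $ X k \<omega>)\<^sup>2)"
      by (intro prod.cong) (auto simp: assms(11) s_def exp_double[symmetric])
    ultimately show ?thesis
      by (simp add: f_def assms(11) s_def)
  qed
  moreover have "prob_space.expectation M (\<lambda>\<omega>. f (\<lambda>k. X k \<omega>)) =
      (\<Sum>a\<in>{1..N} \<rightarrow>\<^sub>E UNIV. path_weight (P \<Delta>t) i N a * f a)"
    using \<open>N \<ge> 1\<close>
    by (intro expectation_markov_paths[OF assms(10)]) (auto simp: f_def intro!: prod.cong)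
  ultimately show ?thesis
    unfolding xbar sandwich_power_path_sum[OF \<open>N \<ge> 1\<close>] by (simp add: f_def s_def)
qed

end
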